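(* For every $n\in\mathbb{N}$, the graph $2L\cup LK_{1,n}$ is not super edge-magic.
   Context: Graphs are finite and undirected, may contain loops, but multiple edges are not allowed. $\mathbb{N}$ denotes the positive integers, and for integers $m\le n$, $[m,n]=\{m,m+1,\dots,n\}$. $L$ is the loop graph: a single vertex with a loop; $2L$ is the disjoint union of two copies of $L$. $LK_{1,n}$ is the graph obtained from the star $K_{1,n}$ (one central vertex joined to $n$ other vertices) by attaching a loop at its central vertex (for $n=1$: an edge with a loop at one of its two endpoints). $\cup$ denotes disjoint union of graphs. Let $G$ be a graph with $p$ vertices and $q$ edges (loops count as edges). $G$ is edge-magic if there is a bijection $f:V(G)\cup E(G)\to[1,p+q]$ and a constant $k$ such that $f(x)+f(xy)+f(y)=k$ for every edge $xy\in E(G)$ (for a loop, $x=y$). $G$ is super edge-magic if there is such an $f$ with, in addition, $f(V(G))=[1,p]$. It is known that, equivalently, $G$ is super edge-magic if and only if there is a bijection $g:V(G)\to[1,p]$ such that $\{g(u)+g(v):uv\in E(G)\}$ is a set of $q$ consecutive integers (a loop at $u$ contributes $2g(u)$). *)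

theory Defs
  imports Main
begin

text \<open>
  Finite undirected graphs with loops allowed and no multiple edges. An edge is the set of its
  end vertices, so the edge \<open>xy\<close> is \<open>{x, y}\<close> and a loop at \<open>x\<close> is the singleton \<open>{x} = {x, x}\<close>.
\<close>

record 'a lgraph =
  verts :: "'a set"
  edges :: "'a set set"

definition wf_lgraph :: "'a lgraph \<Rightarrow> bool" where
  "wf_lgraph G \<longleftrightarrow> finite (verts G) \<and>
     (\<forall>e \<in> edges G. \<exists>x \<in> verts G. \<exists>y \<in> verts G. e = {x, y})"

definition disjoint_union :: "'a lgraph \<Rightarrow> 'b lgraph \<Rightarrow> ('a + 'b) lgraph" where
  "disjoint_union G H =
     \<lparr>verts = verts G <+> verts H,
      edges = (\<lambda>e. Inl ` e) ` edges G \<union> (\<lambda>e. Inr ` e) ` edges H\<rparr>"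

definition add_loop :: "'a \<Rightarrow> 'a lgraph \<Rightarrow> 'a lgraph" where
  "add_loop x G = \<lparr>verts = verts G, edges = insert {x} (edges G)\<rparr>"

definition loop_L :: "unit lgraph" where
  "loop_L = \<lparr>verts = {()}, edges = {{()}}\<rparr>"

definition two_L :: "(unit + unit) lgraph" where
  "two_L = disjoint_union loop_L loop_L"

text \<open>The star \<open>K\<^sub>1\<^sub>,\<^sub>n\<close>, with central vertex \<open>0\<close> and leaves \<open>1, \<dots>, n\<close>.\<close>

definition star :: "nat \<Rightarrow> nat lgraph" where
  "star n = \<lparr>verts = {0..n}, edges = {{0, i} | i. i \<in> {1..n}}\<rparr>"

definition LK1 :: "nat \<Rightarrow> nat lgraph" where
  "LK1 n = add_loop 0 (star n)"

text \<open>
  A labeling lives on the disjoint sum \<open>V(G) + E(G)\<close>. In the magic condition \<open>x = y\<close> is allowed,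
  so a loop at \<open>x\<close> contributes \<open>f(x) + f(xx) + f(x)\<close>.
\<close>

definition edge_magic_labeling :: "'a lgraph \<Rightarrow> ('a + 'a set \<Rightarrow> nat) \<Rightarrow> bool" where
  "edge_magic_labeling G f \<longleftrightarrow>
     bij_betw f (verts G <+> edges G) {1..card (verts G) + card (edges G)} \<and>
     (\<exists>k. \<forall>x y. {x, y} \<in> edges G \<longrightarrow> f (Inl x) + f (Inr {x, y}) + f (Inl y) = k)"

definition edge_magic :: "'a lgraph \<Rightarrow> bool" where
  "edge_magic G \<longleftrightarrow> (\<exists>f. edge_magic_labeling G f)"

definition super_edge_magic :: "'a lgraph \<Rightarrow> bool" where
  "super_edge_magic G \<longleftrightarrow>
     (\<exists>f. edge_magic_labeling G f \<and> f ` (Inl ` verts G) = {1..card (verts G)})"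

text \<open>
  The labeling notions do not include \<^const>\<open>wf_lgraph\<close>; the graphs in question satisfy it.
\<close>

lemma wf_disjoint_union:
  assumes "wf_lgraph G" and "wf_lgraph H"
  shows "wf_lgraph (disjoint_union G H)"
  using assms unfolding wf_lgraph_def disjoint_union_def
  by (fastforce simp: image_iff)

lemma wf_two_L_union_LK1: "wf_lgraph (disjoint_union two_L (LK1 n))"
proof -
  have "wf_lgraph loop_L"
    by (simp add: wf_lgraph_def loop_L_def)
  moreover have "wf_lgraph (LK1 n)"
    by (fastforce simp: wf_lgraph_def LK1_def add_loop_def star_def)
  ultimately show ?thesis
    by (simp add: two_L_def wf_disjoint_union)
qed

end

theory Submission
  imports Defs
begin

text \<open>
  Subtracting the edge labels of a super edge-magic labeling from the magic constant shows that
  the sums of the two end labels fill an interval of \<open>q\<close> consecutive integers. In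
  \<open>2L \<union> LK\<^sub>1\<^sub>,\<^sub>n\<close>, where \<open>p = q\<close>, let \<open>a\<close> and \<open>b\<close> be the labels of the two isolated loop vertices
  and \<open>c\<close> that of the centre. The component \<open>LK\<^sub>1\<^sub>,\<^sub>n\<close> yields the sums \<open>c + x\<close> for all labels
  \<open>x \<noteq> a, b\<close>, its loop being the case \<open>x = c\<close>. So, after a shift by \<open>c\<close>, the interval \<open>{1..p}\<close>
  with the holes \<open>a\<close> and \<open>b\<close>, together with the two points \<open>2a - c\<close> and \<open>2b - c\<close>, has to be an
  interval \<open>{t+1..t+p}\<close>.

  This is impossible for every \<open>t\<close>. If \<open>\<bar>t\<bar> \<ge> 2\<close>, two neighbouring integers of the interval lie
  outside \<open>{1..p}\<close> and would have to be \<open>2a - c\<close> and \<open>2b - c\<close>, which have the same parity. Otherwise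
  a hole inside the interval has to be filled by one of the extra points, and \<open>2a - c \<noteq> a\<close>, so
  \<open>a\<close> can only be filled by \<open>2b - c\<close> and \<open>b\<close> only by \<open>2a - c\<close>. If \<open>t = 0\<close>, both holes are filled
  and \<open>a = b\<close> follows. If \<open>t = 1\<close>, one hole is \<open>1\<close>, say \<open>a = 1\<close>, and filling the other
  gives \<open>b + c = 2\<close> with \<open>b \<noteq> c\<close> positive. The case \<open>t = -1\<close> is the mirror image, with \<open>b + c = 2p\<close>.
\<close>

section \<open>From magic labelings to consecutive sums\<close>

text \<open>
  The sum belonging to the edge \<open>e\<close> is \<open>k - f(e)\<close>, and the edge labels are exactly those left over
  by the vertices, namely \<open>{p+1..p+q}\<close>. Labels and sums are integers
  because the lower end \<open>k - (p + q)\<close> of the interval is then a plain difference.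
\<close>

lemma super_edge_magic_imp_consecutive_sums:
  assumes wf: "wf_lgraph G" and sem: "super_edge_magic G"
  obtains g :: "'a \<Rightarrow> int" and s :: int
  where "bij_betw g (verts G) {1..int (card (verts G))}"
    and "{g x + g y | x y. {x, y} \<in> edges G} = {s..<s + int (card (edges G))}"
proof -
  define p q where "p = card (verts G)" and "q = card (edges G)"
  from sem obtain f k where
    bij: "bij_betw f (verts G <+> edges G) {1..p + q}" and
    vert_labels: "f ` (Inl ` verts G) = {1..p}" and
    magic: "\<And>x y. {x, y} \<in> edges G \<Longrightarrow> f (Inl x) + f (Inr {x, y}) + f (Inl y) = k"
    unfolding super_edge_magic_def edge_magic_labeling_def p_def q_def by blast
  define g where "g = (\<lambda>x. int (f (Inl x)))"
  have inj: "inj_on f (verts G <+> edges G)"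
    using bij by (rule bij_betw_imp_inj_on)
  have "f ` (Inr ` edges G) = f ` ((verts G <+> edges G) - Inl ` verts G)"
    by (rule arg_cong[where f = "image f"]) auto
  also have "\<dots> = f ` (verts G <+> edges G) - f ` (Inl ` verts G)"
    by (rule inj_on_image_set_diff[OF inj]) auto
  also have "\<dots> = {p + 1..p + q}"
    using bij_betw_imp_surj_on[OF bij] vert_labels by auto
  finally have edge_labels: "f ` (Inr ` edges G) = {p + 1..p + q}" .
  have bij_g: "bij_betw g (verts G) {1..int p}"
  proof (rule bij_betw_imageI)
    show "inj_on g (verts G)"
      using inj by (auto simp: g_def inj_on_def)
    have "g ` verts G = int ` (f ` (Inl ` verts G))"
      by (simp add: g_def image_image)
    then show "g ` verts G = {1..int p}"
      by (simp add: vert_labels image_int_atLeastAtMost)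
  qed
  have sum: "g x + g y = int k - int (f (Inr {x, y}))" if "{x, y} \<in> edges G" for x y
    using magic[OF that] by (simp add: g_def)
  have "{g x + g y | x y. {x, y} \<in> edges G} = (\<lambda>e. int k - int (f (Inr e))) ` edges G"
  proof (intro subset_antisym subsetI)
    fix z assume "z \<in> (\<lambda>e. int k - int (f (Inr e))) ` edges G"
    then obtain e where e: "e \<in> edges G" "z = int k - int (f (Inr e))"
      by blast
    obtain x y where xy: "e = {x, y}"
      using wf e(1) unfolding wf_lgraph_def by blast
    then have "z = g x + g y"
      using e sum[of x y] by simp
    then show "z \<in> {g x + g y | x y. {x, y} \<in> edges G}"
      using e(1) xy by blast
  qed (use sum in blast)
  also have "\<dots> = (\<lambda>m. int k - m) ` (int ` (f ` (Inr ` edges G)))"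
    by (simp add: image_image)
  also have "\<dots> = (\<lambda>m. int k - m) ` {int p + 1..int p + int q}"
    by (simp add: edge_labels image_int_atLeastAtMost)
  also have "\<dots> = {int k - int p - int q..<int k - int p - int q + int q}"
    by auto
  finally show thesis
    using that bij_g unfolding p_def q_def by blast
qed

section \<open>The arithmetic obstruction\<close>

text \<open>
  After the shift by \<open>c\<close> the proof uses only two consequences of the equation: a member of
  \<open>{t+1..t+p}\<close> that \<open>{1..p} - {a, b}\<close> does not supply is \<open>2a - c\<close> or \<open>2b - c\<close> (\<open>filled\<close>), and
  an element of \<open>{1..p}\<close> outside that interval is \<open>a\<close> or \<open>b\<close> (\<open>hole\<close>). Parity settles
  \<open>\<bar>t\<bar> \<ge> 2\<close>, and \<open>a\<close>, \<open>b\<close>, \<open>c\<close> being distinct settles the rest.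
\<close>

lemma two_doubles_and_translate_not_interval:
  fixes a b c p s :: int
  assumes range: "a \<in> {1..p}" "b \<in> {1..p}" "c \<in> {1..p}"
    and distinct: "a \<noteq> b" "a \<noteq> c" "b \<noteq> c"
  shows "{2 * a, 2 * b} \<union> (\<lambda>x. c + x) ` ({1..p} - {a, b}) \<noteq> {s..<s + p}"
proof
  assume interval: "{2 * a, 2 * b} \<union> (\<lambda>x. c + x) ` ({1..p} - {a, b}) = {s..<s + p}"
  define t where "t = s - c - 1"
  have shifted: "c + j \<in> {s..<s + p} \<longleftrightarrow> t + 1 \<le> j \<and> j \<le> t + p" for j
    unfolding t_def atLeastLessThan_iff by linarith
  have filled: "j = 2 * a - c \<or> j = 2 * b - c"
    if "t + 1 \<le> j" "j \<le> t + p" "j \<notin> {1..p} - {a, b}" for j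
  proof -
    have "c + j \<in> {2 * a, 2 * b} \<union> (\<lambda>x. c + x) ` ({1..p} - {a, b})"
      unfolding interval shifted using that by blast
    then consider "c + j = 2 * a" | "c + j = 2 * b" | "j \<in> {1..p} - {a, b}"
      unfolding Un_iff insert_iff image_iff empty_iff add_left_cancel by blast
    then show ?thesis
      using that(3) by cases simp_all
  qed
  have hole: "j = a \<or> j = b" if "j \<in> {1..p}" "j < t + 1 \<or> t + p < j" for j
  proof (rule ccontr)
    assume "\<not> (j = a \<or> j = b)"
    then have "c + j \<in> {s..<s + p}"
      unfolding interval[symmetric] using that(1) by blast
    then show False
      using that(2) unfolding shifted by linarith
  qed
  have bounds: "1 \<le> a" "a \<le> p" "1 \<le> b" "b \<le> p" "1 \<le> c" "c \<le> p"
    using range by simp_all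
  then have "p \<ge> 2"
    using distinct(1) by linarith
  have a_filled: "a = 2 * b - c" if "t + 1 \<le> a" "a \<le> t + p"
    using filled[OF that] distinct by simp
  have b_filled: "b = 2 * a - c" if "t + 1 \<le> b" "b \<le> t + p"
    using filled[OF that] distinct by simp
  consider "t \<ge> 2" | "t = 1" | "t = 0" | "t = -1" | "t \<le> -2"
    by linarith
  then show False
  proof cases
    \<comment> \<open>The two largest members exceed \<open>p\<close>.\<close>
    case 1
    have "t + p = 2 * a - c \<or> t + p = 2 * b - c"
      by (rule filled) (use 1 \<open>p \<ge> 2\<close> in simp_all)
    moreover have "t + p - 1 = 2 * a - c \<or> t + p - 1 = 2 * b - c"
      by (rule filled) (use 1 \<open>p \<ge> 2\<close> in simp_all)
    ultimately show False
      by presburger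
  next
    case 2
    have "1 = a \<or> 1 = b"
      by (rule hole) (use 2 \<open>p \<ge> 2\<close> in simp_all)
    then show False
    proof
      assume "1 = a"
      moreover from this have "b = 2 * a - c"
        by (intro b_filled) (use 2 bounds distinct in linarith)+
      ultimately show False
        using bounds distinct by linarith
    next
      assume "1 = b"
      moreover from this have "a = 2 * b - c"
        by (intro a_filled) (use 2 bounds distinct in linarith)+
      ultimately show False
        using bounds distinct by linarith
    qed
  next
    case 3
    then have "a = 2 * b - c" "b = 2 * a - c"
      using a_filled b_filled bounds by simp_all
    then show False
      using distinct(1) by linarith
  next
    case 4
    have "p = a \<or> p = b"
      by (rule hole) (use 4 \<open>p \<ge> 2\<close> in simp_all)
    then show False
    proof
      assume "p = a"
      moreover from this have "b = 2 * a - c"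
        by (intro b_filled) (use 4 bounds distinct in linarith)+
      ultimately show False
        using bounds distinct by linarith
    next
      assume "p = b"
      moreover from this have "a = 2 * b - c"
        by (intro a_filled) (use 4 bounds distinct in linarith)+
      ultimately show False
        using bounds distinct by linarith
    qed
  next
    \<comment> \<open>The two smallest members are at most \<open>0\<close>.\<close>
    case 5
    have "t + 1 = 2 * a - c \<or> t + 1 = 2 * b - c"
      by (rule filled) (use 5 \<open>p \<ge> 2\<close> in simp_all)
    moreover have "t + 2 = 2 * a - c \<or> t + 2 = 2 * b - c"
      by (rule filled) (use 5 \<open>p \<ge> 2\<close> in simp_all)
    ultimately show False
      by presburger
  qed
qed

section \<open>The graph \<open>2L \<union> LK\<^sub>1\<^sub>,\<^sub>n\<close>\<close>

lemma verts_two_L_union_LK1: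
  "verts (disjoint_union two_L (LK1 n)) = {Inl (Inl ()), Inl (Inr ())} \<union> Inr ` {0..n}"
  by (auto simp: disjoint_union_def two_L_def loop_L_def LK1_def add_loop_def star_def)

text \<open>The loop at the centre is the edge \<open>{0, 0}\<close>, so it needs no separate clause.\<close>

lemma edges_two_L_union_LK1:
  "edges (disjoint_union two_L (LK1 n)) =
     {{Inl (Inl ())}, {Inl (Inr ())}} \<union> (\<lambda>i. {Inr 0, Inr i}) ` {0..n}"
proof -
  have "{0..n} = insert 0 {1..n}"
    by auto
  moreover have "edges (LK1 n) = insert {0} ((\<lambda>i. {0, i}) ` {1..n})"
    unfolding LK1_def add_loop_def star_def by (simp only: lgraph.simps Setcompr_eq_image)
  ultimately have "edges (LK1 n) = (\<lambda>i. {0, i}) ` {0..n}"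
    by simp
  then show ?thesis
    by (simp add: disjoint_union_def two_L_def loop_L_def image_image insert_commute)
qed

lemma card_verts_two_L_union_LK1:
  "card (verts (disjoint_union two_L (LK1 n))) = n + 3"
proof -
  have "card (Inr ` {0..n} :: ((unit + unit) + nat) set) = n + 1"
    by (simp add: card_image)
  moreover have "{Inl (Inl ()), Inl (Inr ())} \<inter> Inr ` {0..n} = {}"
    by blast
  ultimately show ?thesis
    unfolding verts_two_L_union_LK1 by (simp add: card_Un_disjoint)
qed

lemma card_edges_two_L_union_LK1:
  "card (edges (disjoint_union two_L (LK1 n))) = n + 3"
proof -
  let ?spokes = "(\<lambda>i. {Inr 0, Inr i}) ` {0..n} :: ((unit + unit) + nat) set set"
  have "inj_on (\<lambda>i. {Inr 0, Inr i} :: ((unit + unit) + nat) set) {0..n}"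
    by (auto simp: inj_on_def doubleton_eq_iff)
  then have "card ?spokes = n + 1"
    by (simp add: card_image)
  moreover have "{{Inl (Inl ())}, {Inl (Inr ())}} \<inter> ?spokes = {}"
    by blast
  ultimately show ?thesis
    unfolding edges_two_L_union_LK1 by (simp add: card_Un_disjoint)
qed

lemma edge_sums_two_L_union_LK1:
  fixes g :: "(unit + unit) + nat \<Rightarrow> int"
  shows "{g x + g y | x y. {x, y} \<in> edges (disjoint_union two_L (LK1 n))} =
    {2 * g (Inl (Inl ())), 2 * g (Inl (Inr ()))} \<union> (\<lambda>i. g (Inr 0) + g (Inr i)) ` {0..n}"
    (is "?S = ?T")
proof (intro subset_antisym subsetI)
  fix z assume "z \<in> ?S"
  then obtain x y where z: "z = g x + g y"
    and "{x, y} \<in> edges (disjoint_union two_L (LK1 n))"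
    by blast
  then consider "{x, y} = {Inl (Inl ())}" | "{x, y} = {Inl (Inr ())}"
    | i where "i \<in> {0..n}" "{x, y} = {Inr 0, Inr i}"
    unfolding edges_two_L_union_LK1 by blast
  then show "z \<in> ?T"
  proof cases
    case 1
    then have "x = Inl (Inl ())" "y = Inl (Inl ())"
      by blast+
    then show ?thesis
      using z by simp
  next
    case 2
    then have "x = Inl (Inr ())" "y = Inl (Inr ())"
      by blast+
    then show ?thesis
      using z by simp
  next
    case 3
    from 3(2) have "z = g (Inr 0) + g (Inr i)"
      unfolding z doubleton_eq_iff by auto
    then show ?thesis
      using 3(1) by blast
  qed
next
  have sum_mem: "g x + g y \<in> ?S" if "{x, y} \<in> edges (disjoint_union two_L (LK1 n))" for x y
    using that by blast
  fix z assume "z \<in> ?T"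
  then consider "z = 2 * g (Inl (Inl ()))" | "z = 2 * g (Inl (Inr ()))"
    | i where "i \<in> {0..n}" "z = g (Inr 0) + g (Inr i)"
    by blast
  then show "z \<in> ?S"
  proof cases
    case 1
    then show ?thesis
      using sum_mem[of "Inl (Inl ())" "Inl (Inl ())"] by (simp add: edges_two_L_union_LK1)
  next
    case 2
    then show ?thesis
      using sum_mem[of "Inl (Inr ())" "Inl (Inr ())"] by (simp add: edges_two_L_union_LK1)
  next
    case 3
    then show ?thesis
      using sum_mem[of "Inr 0" "Inr i"] unfolding edges_two_L_union_LK1 by blast
  qed
qed

theorem theorem3p3:
  fixes n :: nat
  assumes "n \<ge> 1"
  shows "\<not> super_edge_magic (disjoint_union two_L (LK1 n))"
proof
  let ?G = "disjoint_union two_L (LK1 n)"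
  define p where "p = int (n + 3)"
  assume "super_edge_magic ?G"
  then obtain g :: "(unit + unit) + nat \<Rightarrow> int" and s
    where bij: "bij_betw g (verts ?G) {1..p}"
      and sums: "{g x + g y | x y. {x, y} \<in> edges ?G} = {s..<s + p}"
    by (rule super_edge_magic_imp_consecutive_sums[OF wf_two_L_union_LK1[of n],
          unfolded card_verts_two_L_union_LK1 card_edges_two_L_union_LK1, folded p_def])
  define a b c where "a = g (Inl (Inl ()))" and "b = g (Inl (Inr ()))" and "c = g (Inr 0)"
  have inj: "inj_on g (verts ?G)"
    using bij by (rule bij_betw_imp_inj_on)
  have image: "g ` verts ?G = {1..p}"
    using bij by (rule bij_betw_imp_surj_on)
  have labels: "a \<in> {1..p}" "b \<in> {1..p}" "c \<in> {1..p}"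
    unfolding image[symmetric] a_def b_def c_def verts_two_L_union_LK1 by simp_all
  have distinct: "a \<noteq> b" "a \<noteq> c" "b \<noteq> c"
    unfolding a_def b_def c_def
    by (simp_all add: inj_on_eq_iff[OF inj] verts_two_L_union_LK1)
  have "g ` (Inr ` {0..n}) = g ` (verts ?G - {Inl (Inl ()), Inl (Inr ())})"
    unfolding verts_two_L_union_LK1 by (rule arg_cong[where f = "image g"]) blast
  also have "\<dots> = g ` verts ?G - g ` {Inl (Inl ()), Inl (Inr ())}"
    by (rule inj_on_image_set_diff[OF inj]) (auto simp: verts_two_L_union_LK1)
  also have "\<dots> = {1..p} - {a, b}"
    unfolding image a_def b_def by simp
  finally have LK1_labels: "g ` (Inr ` {0..n}) = {1..p} - {a, b}" .
  have "(\<lambda>i. g (Inr 0) + g (Inr i)) ` {0..n} = (\<lambda>x. c + x) ` ({1..p} - {a, b})"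
    unfolding LK1_labels[symmetric] image_image c_def ..
  then have "{2 * a, 2 * b} \<union> (\<lambda>x. c + x) ` ({1..p} - {a, b}) = {s..<s + p}"
    using sums unfolding edge_sums_two_L_union_LK1 a_def b_def by (rule subst)
  with two_doubles_and_translate_not_interval[OF labels distinct] show False
    by (rule notE)
qed

end
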